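(* For every positive integer $n$ there exist infinitely many integers $h$ such that the equation of degree 10 $$\begin{aligned} &(x_1^2+2x_2^2)^4(x_1^2+x_2^2)+(x_1^2+2x_2^2)^3(x_3^2+2x_4^2)(2x_1^2+3x_2^2)-(x_3^2+2x_4^2)^5\\ &+(x_1^2+2x_2^2)^3\{x_1^4+4x_1^2x_2^2+4x_2^4-4x_2^2x_3^2-8x_2^2x_4^2-x_3^4-4x_3^2x_4^2-4x_4^4\\ &\quad+2hx_2(x_1^2x_3-2x_1^2x_4+2x_2^2x_3-4x_2^2x_4+x_3^3+2x_3x_4^2)\}=0 \end{aligned}$$ has at least $n$ distinct rational solutions $(x_1,x_2,x_3,x_4)$.
   Context: Solutions differing by a nonzero rational scalar factor are considered equivalent and are counted as one solution; solutions considered satisfy $(x_1,x_2)\neq(0,0)$ and $(x_3,x_4)\neq(0,0)$. *)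

theory Defs
  imports Complex_Main
begin

type_synonym point4 = "rat \<times> rat \<times> rat \<times> rat"

definition lhs :: "int \<Rightarrow> point4 \<Rightarrow> rat" where
  "lhs h = (\<lambda>(x1, x2, x3, x4).
     (x1^2 + 2*x2^2)^4 * (x1^2 + x2^2)
     + (x1^2 + 2*x2^2)^3 * (x3^2 + 2*x4^2) * (2*x1^2 + 3*x2^2)
     - (x3^2 + 2*x4^2)^5
     + (x1^2 + 2*x2^2)^3 *
         (x1^4 + 4*x1^2*x2^2 + 4*x2^4 - 4*x2^2*x3^2 - 8*x2^2*x4^2
          - x3^4 - 4*x3^2*x4^2 - 4*x4^4
          + 2*of_int h*x2 *
              (x1^2*x3 - 2*x1^2*x4 + 2*x2^2*x3 - 4*x2^2*x4 + x3^3 + 2*x3*x4^2)))"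

definition solutions :: "int \<Rightarrow> point4 set" where
  "solutions h = {(x1, x2, x3, x4).
     lhs h (x1, x2, x3, x4) = 0 \<and> (x1, x2) \<noteq> (0, 0) \<and> (x3, x4) \<noteq> (0, 0)}"

definition scalar_rel :: "(point4 \<times> point4) set" where
  "scalar_rel = {((x1, x2, x3, x4), (y1, y2, y3, y4)).
     \<exists>c. c \<noteq> 0 \<and> y1 = c * x1 \<and> y2 = c * x2 \<and> y3 = c * x3 \<and> y4 = c * x4}"

lemma equiv_scalar_rel: "equiv UNIV scalar_rel"
proof (rule equivI)
  show "refl scalar_rel"
    by (auto simp: refl_on_def scalar_rel_def intro: exI[of _ 1])
  show "sym scalar_rel"
  proof (rule symI)
    fix x y assume "(x, y) \<in> scalar_rel"
    then obtain x1 x2 x3 x4 c where "x = (x1, x2, x3, x4)" "c \<noteq> 0"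
      "y = (c * x1, c * x2, c * x3, c * x4)"
      by (auto simp: scalar_rel_def)
    then show "(y, x) \<in> scalar_rel"
      by (auto simp: scalar_rel_def intro!: exI[of _ "1 / c"])
  qed
  show "trans scalar_rel"
  proof (rule transI)
    fix x y z assume "(x, y) \<in> scalar_rel" "(y, z) \<in> scalar_rel"
    then obtain x1 x2 x3 x4 c d where "x = (x1, x2, x3, x4)" "c \<noteq> 0" "d \<noteq> 0"
      "z = (d * (c * x1), d * (c * x2), d * (c * x3), d * (c * x4))"
      by (auto simp: scalar_rel_def)
    then show "(x, z) \<in> scalar_rel"
      by (auto simp: scalar_rel_def intro!: exI[of _ "d * c"])
  qed
qed simp

text \<open>Distinct solutions are scalar classes. There may be infinitely many of them, so ``at least
  \<open>n\<close>'' is not phrased as a bound on the cardinality of the whole quotient.\<close>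

definition at_least_n_solutions :: "nat \<Rightarrow> int \<Rightarrow> bool" where
  "at_least_n_solutions n h \<longleftrightarrow>
     (\<exists>T. T \<subseteq> solutions h // scalar_rel \<and> finite T \<and> card T = n)"

end

theory Submission imports Defs begin

text \<open>
  Write \<open>N = x\<^sub>1\<^sup>2 + 2 x\<^sub>2\<^sup>2\<close> and \<open>M = x\<^sub>3\<^sup>2 + 2 x\<^sub>4\<^sup>2\<close>. On the slice \<open>N = M\<close> the left-hand side of the
  equation is \<open>2 N\<^sup>4 (x\<^sub>1\<^sup>2 - x\<^sub>2\<^sup>2 + 2 h x\<^sub>2 (x\<^sub>3 - x\<^sub>4))\<close>, so the equation holds on the intersection of
  two quadrics in projective 3-space (\<open>lhs_eq_0_if_quadrics\<close>). For \<open>h \<noteq> 0\<close> this is a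
  curve of genus 1 with the rational point \<open>(1, 1, 1, 1)\<close>, and its Weierstrass form is
  \<open>y\<^sup>2 = (x + 3 h\<^sup>2) (x\<^sup>2 - 2 x + 12 h\<^sup>2)\<close>.

  The Weierstrass curve has the rational point \<open>(0, 6 h\<^sup>2)\<close>, and its double has abscissa
  \<open>9/4 - 3 h\<^sup>2\<close>, which is not integral at 2. As in the proof of the Nagell--Lutz theorem, doubling
  a point whose abscissa has 2-adic valuation \<open>-2 k < 0\<close> yields one with valuation \<open>-2 (k + 1)\<close>
  (\<open>pole_order_tangent\<close>). Repeated doubling therefore never returns to an earlier
  abscissa, and every positive integer \<open>h\<close> has infinitely many solutions, not just \<open>n\<close>.

  The points are carried back to solutions by explicit formulas (\<open>curve_to_quartic\<close>,
  \<open>quartic_to_quadrics\<close>), and the abscissa is recovered from the solution class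
  (\<open>abscissa_determined_by_class\<close>).
\<close>

section \<open>Doubling on a Weierstrass cubic and poles at 2\<close>

definition weierstrass :: "int \<Rightarrow> int \<Rightarrow> int \<Rightarrow> rat \<Rightarrow> rat" where
  "weierstrass a b c x = x^3 + of_int a * x^2 + of_int b * x + of_int c"

text \<open>The 2-adic valuation of \<open>x\<close> is \<open>-2 k\<close>. Only even pole orders occur on a monic cubic with integral
  coefficients, since \<open>y\<^sup>2\<close> then has valuation three times that of \<open>x\<close>.\<close>

definition pole_order :: "nat \<Rightarrow> rat \<Rightarrow> bool" where
  "pole_order k x \<longleftrightarrow> (\<exists>p q :: int. odd p \<and> odd q \<and> x = of_int p / (of_int q * 4 ^ k))"

lemma odd_of_int_neq_0: "odd (p :: int) \<Longrightarrow> (of_int p :: rat) \<noteq> 0"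
  by auto

lemma pole_order_le:
  assumes "pole_order k x" "pole_order l x"
  shows "k \<le> l"
proof (rule ccontr)
  assume "\<not> k \<le> l"
  then obtain m where k: "k = Suc (l + m)"
    by (metis less_iff_Suc_add not_le)
  obtain p q r s :: int where odd: "odd p" "odd q" "odd r" "odd s"
    and x: "x = of_int p / (of_int q * 4 ^ k)" "x = of_int r / (of_int s * 4 ^ l)"
    using assms unfolding pole_order_def by blast
  have "(of_int p :: rat) * of_int s * 4 ^ l = of_int r * of_int q * 4 ^ k"
    using x odd odd_of_int_neq_0[of q] odd_of_int_neq_0[of s] by (simp add: field_simps)
  then have "(of_int p :: rat) * of_int s = of_int r * of_int q * 4 ^ Suc m"
    by (simp add: k power_add field_simps)
  then have "p * s = r * q * 4 ^ Suc m"
    by (metis (mono_tags, lifting) of_int_eq_iff of_int_mult of_int_numeral of_int_power)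
  then have "even (p * s)" by simp
  then show False using odd by simp
qed

lemma pole_order_unique: "pole_order k x \<Longrightarrow> pole_order l x \<Longrightarrow> k = l"
  by (simp add: pole_order_le le_antisym)

lemma pole_order_not_int:
  assumes "pole_order k x" "k > 0"
  shows "x \<noteq> of_int z"
proof
  assume x: "x = of_int z"
  obtain p q :: int where odd: "odd p" "odd q" and "x = of_int p / (of_int q * 4 ^ k)"
    using assms unfolding pole_order_def by blast
  then have "(of_int p :: rat) = of_int z * of_int q * 4 ^ k"
    using x odd_of_int_neq_0[of q] by (simp add: field_simps)
  then have "p = z * q * 4 ^ k"
    by (metis (mono_tags, lifting) of_int_eq_iff of_int_mult of_int_numeral of_int_power)
  then show False using odd \<open>k > 0\<close> by simp
qed

text \<open>The tangent at \<open>(x, y)\<close> has slope \<open>f'(x) / (2 y)\<close>, and \<open>f'(x)\<^sup>2 / (4 f(x)) - a - 2 x\<close> is the abscissa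
  of its third intersection with the cubic. The first term has two more factors of 2 in the
  denominator than \<open>x\<close>, so it dominates the others 2-adically.\<close>

lemma pole_order_tangent:
  fixes a b c :: int
  assumes "pole_order k x" "k > 0"
  shows "weierstrass a b c x \<noteq> 0"
    and "pole_order (Suc k) ((3*x^2 + 2*of_int a*x + of_int b)^2 / (4 * weierstrass a b c x)
           - of_int a - 2*x)"
proof -
  obtain p q :: int where odd: "odd p" "odd q" and x: "x = of_int p / (of_int q * 4 ^ k)"
    using assms unfolding pole_order_def by blast
  define e :: int where "e = 4 ^ k"
  define Q :: rat where "Q = of_int q"
  define P :: rat where "P = of_int p"
  define E :: rat where "E = of_int e"
  have E: "E = 4 ^ k" by (simp add: E_def e_def)
  have nz: "Q \<noteq> 0" "E \<noteq> 0" using odd by (auto simp: Q_def E)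
  have "even e" using \<open>k > 0\<close> by (simp add: e_def)
  define F where "F = 3*p^2 + 2*a*p*q*e + b*q^2*e^2"
  define G where "G = p^3 + a*p^2*q*e + b*p*q^2*e^2 + c*q^3*e^3"
  have oddF: "odd F" and oddG: "odd G"
    using odd \<open>even e\<close> by (auto simp: F_def G_def)
  have xx: "x = P / (Q * E)" by (simp add: x P_def Q_def E)
  have G: "weierstrass a b c x = of_int G / (Q^3 * E^3)"
    unfolding weierstrass_def xx using nz
    by (simp add: G_def P_def[symmetric] Q_def[symmetric] E_def[symmetric] field_simps power2_eq_square power3_eq_cube)
  have F: "3*x^2 + 2*of_int a*x + of_int b = of_int F / (Q^2 * E^2)"
    unfolding xx using nz
    by (simp add: F_def P_def[symmetric] Q_def[symmetric] E_def[symmetric] field_simps power2_eq_square)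
  have G0: "(of_int G :: rat) \<noteq> 0" using oddG by (rule odd_of_int_neq_0)
  show "weierstrass a b c x \<noteq> 0" using G G0 nz by simp
  have "(3*x^2 + 2*of_int a*x + of_int b)^2 / (4 * weierstrass a b c x) - of_int a - 2*x
      = (of_int F^2 - of_int a*Q*of_int G*(4*E) - 8*P*of_int G) / (Q*of_int G*(4*E))"
    unfolding F G unfolding xx using nz G0
    by (simp add: field_simps power2_eq_square power3_eq_cube)
  also have "\<dots> = of_int (F^2 - a*q*G*(4*e) - 8*p*G) / (of_int (q*G) * 4^Suc k)"
    by (simp add: P_def Q_def E_def e_def)
  finally show "pole_order (Suc k) ((3*x^2 + 2*of_int a*x + of_int b)^2 / (4 * weierstrass a b c x)
           - of_int a - 2*x)"
    unfolding pole_order_def using oddF oddG odd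
    by (intro exI[of _ "F^2 - a*q*G*(4*e) - 8*p*G"] exI[of _ "q*G"]) auto
qed

lemma weierstrass_tangent:
  assumes y: "y^2 = weierstrass a b c x" "y \<noteq> 0"
    and m: "m = (3*x^2 + 2*of_int a*x + of_int b) / (2*y)"
    and x': "x' = m^2 - of_int a - 2*x"
  shows "(m*(x' - x) + y)^2 = weierstrass a b c x'"
proof -
  have 1: "2*m*y = 3*x^2 + 2*of_int a*x + of_int b" using y(2) m by simp
  have c: "of_int c = y^2 - x^3 - of_int a*x^2 - of_int b*x"
    using y(1) by (simp add: weierstrass_def)
  have b: "of_int b = 2*m*y - 3*x^2 - 2*of_int a*x" using 1 by simp
  have a: "of_int a = m^2 - x' - 2*x" using x' by simp
  show ?thesis unfolding weierstrass_def c b a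
    by (simp add: algebra_simps power2_eq_square power3_eq_cube)
qed

lemma infinite_rational_points:
  fixes a b c :: int
  assumes "pole_order 1 x0" "y0^2 = weierstrass a b c x0"
  shows "infinite {x. x \<notin> \<int> \<and> (\<exists>y. y^2 = weierstrass a b c x)}"
proof -
  have ex: "\<exists>x y. pole_order (Suc k) x \<and> y^2 = weierstrass a b c x" for k
  proof (induction k)
    case 0
    then show ?case using assms by auto
  next
    case (Suc k)
    then obtain x y where x: "pole_order (Suc k) x" and y: "y^2 = weierstrass a b c x" by blast
    define m where "m = (3*x^2 + 2*of_int a*x + of_int b) / (2*y)"
    define x' where "x' = m^2 - of_int a - 2*x"
    have "y \<noteq> 0" using pole_order_tangent(1)[OF x, of a b c] y by auto
    then have "(m*(x' - x) + y)^2 = weierstrass a b c x'"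
      using weierstrass_tangent[OF y _ m_def x'_def] by simp
    moreover have "pole_order (Suc (Suc k)) x'"
      using pole_order_tangent(2)[OF x, of a b c]
      by (simp add: x'_def m_def y[symmetric] power_divide power_mult_distrib)
    ultimately show ?case by blast
  qed
  then obtain X where X: "\<And>k. pole_order (Suc k) (X k)"
    "\<And>k. \<exists>y. y^2 = weierstrass a b c (X k)" by metis
  have "inj X"
    by (rule injI) (metis X(1) pole_order_unique nat.inject)
  then have "infinite (range X)" using finite_imageD infinite_UNIV_nat by blast
  moreover have "range X \<subseteq> {x. x \<notin> \<int> \<and> (\<exists>y. y^2 = weierstrass a b c x)}"
    using X pole_order_not_int by (fastforce elim!: Ints_cases)
  ultimately show ?thesis by (rule infinite_super[rotated])
qed

section \<open>The elliptic curve inside the degree 10 surface\<close>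

lemma lhs_eq_0_if_quadrics:
  assumes "x1^2 + 2*x2^2 = x3^2 + 2*x4^2"
    and "x1^2 = x2^2 - 2*of_int h*x2*(x3 - x4)"
  shows "lhs h (x1, x2, x3, x4) = 0"
proof -
  define N where "N = x1^2 + 2*x2^2"
  have N: "x3^2 + 2*x4^2 = N" using assms(1) by (simp add: N_def)
  have inner: "x1^4 + 4*x1^2*x2^2 + 4*x2^4 - 4*x2^2*x3^2 - 8*x2^2*x4^2
          - x3^4 - 4*x3^2*x4^2 - 4*x4^4
          + 2*of_int h*x2 *
              (x1^2*x3 - 2*x1^2*x4 + 2*x2^2*x3 - 4*x2^2*x4 + x3^3 + 2*x3*x4^2)
      = (x1^2 + 2*x2^2)^2 - 4*x2^2*(x3^2 + 2*x4^2) - (x3^2 + 2*x4^2)^2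
        + 2*of_int h*x2 * ((x1^2 + 2*x2^2)*(x3 - 2*x4) + x3*(x3^2 + 2*x4^2))"
    by algebra
  have "lhs h (x1, x2, x3, x4) = N^4*(x1^2 + x2^2) + N^3*N*(2*x1^2 + 3*x2^2) - N^5
      + N^3*(N^2 - 4*x2^2*N - N^2 + 2*of_int h*x2*(N*(x3 - 2*x4) + x3*N))"
    unfolding lhs_def prod.case inner N N_def[symmetric] ..
  also have "\<dots> = N^4 * (3*x1^2 - N + 4*of_int h*x2*(x3 - x4))"
    by algebra
  also have "3*x1^2 - N + 4*of_int h*x2*(x3 - x4) = 0"
    using assms(2) by (simp add: N_def algebra_simps)
  finally show ?thesis by simp
qed

text \<open>With \<open>x\<^sub>2 = 1\<close>, eliminating \<open>x\<^sub>1\<close> from the two quadrics leaves a conic in \<open>(x\<^sub>3, x\<^sub>4)\<close> through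
  \<open>(1, 1)\<close>. The line through \<open>(1, 1)\<close> with direction \<open>(\<beta> + 1, \<beta>)\<close> meets it again at the rational point
  written here after clearing the denominator \<open>q = 3 \<beta>\<^sup>2 + 2 \<beta> + 1\<close>. What remains is that
  \<open>q\<^sup>2 x\<^sub>1\<^sup>2\<close>, a quartic in \<open>\<beta>\<close>, be the square \<open>v\<^sup>2\<close> of a rational number.\<close>

definition conic_q :: "rat \<Rightarrow> rat" where
  "conic_q \<beta> = 3*\<beta>^2 + 2*\<beta> + 1"

definition quartic_point :: "rat \<Rightarrow> rat \<Rightarrow> rat \<Rightarrow> point4" where
  "quartic_point h \<beta> v = (v, conic_q \<beta>, conic_q \<beta> - 2*(\<beta> + 1)*(h + 1 + 3*\<beta>),
     conic_q \<beta> - 2*\<beta>*(h + 1 + 3*\<beta>))"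

lemma conic_q_pos: "conic_q \<beta> > 0"
proof -
  have "conic_q \<beta> = 2*\<beta>^2 + (\<beta> + 1)^2"
    by (simp add: conic_q_def power2_eq_square algebra_simps)
  then show ?thesis
    by (cases "\<beta> = 0") (simp_all add: add_pos_nonneg)
qed

lemma quartic_to_quadrics:
  assumes v: "v^2 = conic_q \<beta> * (conic_q \<beta> + 4*of_int h*(of_int h + 1 + 3*\<beta>))"
  shows "quartic_point (of_int h) \<beta> v \<in> solutions h"
proof -
  define q L where "q = conic_q \<beta>" and "L = of_int h + 1 + 3*\<beta>"
  define x3 x4 where "x3 = q - 2*(\<beta> + 1)*L" and "x4 = q - 2*\<beta>*L"
  have q: "3*\<beta>^2 + 2*\<beta> + 1 = q" by (simp add: q_def conic_q_def)
  have h: "of_int h = L - 1 - 3*\<beta>" by (simp add: L_def)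
  have v': "v^2 = q*(q + 4*of_int h*L)" using v by (simp add: q_def L_def)
  have quadric1: "v^2 + 2*q^2 = x3^2 + 2*x4^2"
    unfolding v' x3_def x4_def h q[symmetric] by algebra
  have quadric2: "v^2 = q^2 - 2*of_int h*q*(x3 - x4)"
    unfolding v' x3_def x4_def by algebra
  have "q > 0" by (simp add: q_def conic_q_pos)
  then have "v^2 + 2*q^2 > 0" by (simp add: add_nonneg_pos)
  then have "(x3, x4) \<noteq> (0, 0)" using quadric1 by auto
  moreover have "quartic_point (of_int h) \<beta> v = (v, q, x3, x4)"
    by (simp add: quartic_point_def q_def L_def x3_def x4_def)
  ultimately show ?thesis
    using lhs_eq_0_if_quadrics[OF quadric1 quadric2] \<open>q > 0\<close> by (simp add: solutions_def)
qed

text \<open>The second intersection with the conic gives the slope \<open>\<beta>\<close> back, as the direction seen from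
  \<open>(1, 1)\<close>, unless it is \<open>(1, 1)\<close> itself. That happens exactly on the tangent, so for only one value
  \<open>\<beta> = - (h + 1) / 3\<close>, and injectivity survives.\<close>

lemma quartic_point_inj_on_classes:
  assumes "(quartic_point h \<beta> v, quartic_point h \<beta>' v') \<in> scalar_rel"
  shows "\<beta> = \<beta>' \<and> v = v'"
proof -
  define q q' L L' where "q = conic_q \<beta>" and "q' = conic_q \<beta>'"
    and "L = h + 1 + 3*\<beta>" and "L' = h + 1 + 3*\<beta>'"
  have pos: "q > 0" "q' > 0" by (simp_all add: q_def q'_def conic_q_pos)
  obtain c where "c \<noteq> 0" and c: "v' = c*v" "q' = c*q"
      "q' - 2*(\<beta>' + 1)*L' = c*(q - 2*(\<beta> + 1)*L)" "q' - 2*\<beta>'*L' = c*(q - 2*\<beta>*L)"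
    using assms
    by (auto simp: scalar_rel_def quartic_point_def q_def q'_def L_def L'_def)
  from c(2,4) have bL: "\<beta>'*L' = c*(\<beta>*L)" by (simp add: algebra_simps)
  with c(2,3) have L: "L' = c*L" by (simp add: algebra_simps)
  have "\<beta>' = \<beta>"
  proof (cases "L = 0")
    case True
    then have "L' = 0" using L by simp
    with True show ?thesis by (simp add: L_def L'_def)
  next
    case False
    from bL L have "c*L*\<beta>' = c*L*\<beta>" by (simp add: algebra_simps)
    then show ?thesis using False \<open>c \<noteq> 0\<close> by simp
  qed
  then have "q' = q" by (simp add: q_def q'_def)
  then have "c = 1" using c(2) pos by simp
  then show ?thesis using c(1) \<open>\<beta>' = \<beta>\<close> by simp
qed

section \<open>From the Weierstrass form to solutions\<close>

text \<open>The quartic has leading coefficient \<open>3\<^sup>2\<close>, so \<open>v = 3 \<beta>\<^sup>2 + (2 + 6 h) \<beta> + \<xi>\<close> cancels the two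
  highest terms of \<open>v\<^sup>2\<close> against the quartic and leaves a quadratic equation in \<open>\<beta>\<close>. Its discriminant
  is a cubic in \<open>\<xi>\<close>, which the substitution \<open>\<xi> = 2 h + 1 - 2 x / 3\<close> turns into the Weierstrass cubic.
  The formulas below are \<open>\<beta>\<close> as a root of that quadratic and the resulting \<open>v\<close>.\<close>

definition curve_beta :: "rat \<Rightarrow> rat \<Rightarrow> rat \<Rightarrow> rat" where
  "curve_beta h x y = (6*h^2 - (1 + 3*h)*x + y) / (3*(x - 6*h^2))"

definition curve_v :: "rat \<Rightarrow> rat \<Rightarrow> rat \<Rightarrow> rat" where
  "curve_v h x y = 3*(curve_beta h x y)^2 + (2 + 6*h)*curve_beta h x y + 2*h + 1 - 2*x/3"

lemma curve_to_quartic: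
  assumes y: "y^2 = (x + 3*h^2)*(x^2 - 2*x + 12*h^2)" and x: "x \<noteq> 6*h^2"
  shows "(curve_v h x y)^2
    = conic_q (curve_beta h x y) * (conic_q (curve_beta h x y) + 4*h*(h + 1 + 3*curve_beta h x y))"
proof -
  define \<beta> where "\<beta> = curve_beta h x y"
  define \<xi> where "\<xi> = 2*h + 1 - 2*x/3"
  define A B C where "A = 4*(x - 6*h^2)" and "B = (4 + 12*h)*x/3 - 8*h^2"
    and "C = (2*h + 1)^2 - \<xi>^2"
  have "A \<noteq> 0" using x by (simp add: A_def)
  have "3*(x - 6*h^2)*\<beta> = 6*h^2 - (1 + 3*h)*x + y"
    using x by (simp add: \<beta>_def curve_beta_def)
  then have lin: "A*\<beta> + B = 4*y/3" by (simp add: A_def B_def field_simps)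
  have disc: "(4*y/3)^2 = B^2 - A*C"
  proof -
    have "(4*y/3)^2 = 16/9 * ((x + 3*h^2)*(x^2 - 2*x + 12*h^2))"
      unfolding y[symmetric] by (simp add: power2_eq_square)
    also have "\<dots> = B^2 - A*C"
      by (simp add: A_def B_def C_def \<xi>_def field_simps power2_eq_square)
    finally show ?thesis .
  qed
  have "A*(A*\<beta>^2 + 2*B*\<beta> + C) = (A*\<beta> + B)^2 - (B^2 - A*C)"
    by algebra
  also have "\<dots> = 0" by (simp add: lin disc)
  finally have quad: "A*\<beta>^2 + 2*B*\<beta> + C = 0" using \<open>A \<noteq> 0\<close> by simp
  have "conic_q \<beta> * (conic_q \<beta> + 4*h*(h + 1 + 3*\<beta>)) - (3*\<beta>^2 + (2 + 6*h)*\<beta> + \<xi>)^2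
      = A*\<beta>^2 + 2*B*\<beta> + C"
    by (simp add: A_def B_def C_def \<xi>_def conic_q_def field_simps power2_eq_square)
  then have "(3*\<beta>^2 + (2 + 6*h)*\<beta> + \<xi>)^2 = conic_q \<beta> * (conic_q \<beta> + 4*h*(h + 1 + 3*\<beta>))"
    by (simp add: quad)
  then show ?thesis by (simp add: curve_v_def \<beta>_def[symmetric] \<xi>_def algebra_simps)
qed

text \<open>The class determines \<open>\<beta>\<close> and \<open>v\<close>, and the formula for \<open>v\<close> is affine in \<open>x\<close> once \<open>\<beta>\<close> is known.\<close>

lemma abscissa_determined_by_class:
  assumes "(quartic_point h (curve_beta h x y) (curve_v h x y),
            quartic_point h (curve_beta h x' y') (curve_v h x' y')) \<in> scalar_rel"
  shows "x = x'"
  using quartic_point_inj_on_classes[OF assms] by (auto simp: curve_v_def)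

lemma infinite_solution_classes:
  assumes "h > 0"
  shows "infinite (solutions h // scalar_rel)"
proof -
  define r :: rat where "r = of_int h"
  define a b c where "a = 3*h^2 - 2" and "b = 6*h^2" and "c = 36*h^4"
  have W: "weierstrass a b c x = (x + 3*r^2)*(x^2 - 2*x + 12*r^2)" for x
    unfolding weierstrass_def a_def b_def c_def r_def
    by (simp add: algebra_simps power2_eq_square power3_eq_cube power4_eq_xxxx)
  define S where "S = {x. x \<notin> \<int> \<and> (\<exists>y. y^2 = weierstrass a b c x)}"
  \<comment> \<open>The starting point is the double of \<open>(0, 6 h\<^sup>2)\<close>, where the tangent has slope 1/2.\<close>
  have "pole_order 1 (9/4 - 3*r^2)"
    unfolding pole_order_def
    by (intro exI[of _ "9 - 12*h^2"] exI[of _ 1]) (simp add: r_def field_simps)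
  moreover have "(9/8 + 9*r^2/2)^2 = weierstrass a b c (9/4 - 3*r^2)"
    unfolding W by (simp add: field_simps power2_eq_square)
  ultimately have "infinite S"
    unfolding S_def by (rule infinite_rational_points)
  define Y where "Y x = (SOME y. y^2 = weierstrass a b c x)" for x
  have Y: "(Y x)^2 = (x + 3*r^2)*(x^2 - 2*x + 12*r^2)" if "x \<in> S" for x
    using that someI_ex[of "\<lambda>y. y^2 = weierstrass a b c x"] by (simp add: S_def Y_def W)
  define \<Phi> where "\<Phi> x = quartic_point r (curve_beta r x (Y x)) (curve_v r x (Y x))" for x
  have "\<Phi> x \<in> solutions h" if "x \<in> S" for x
  proof -
    have "6*r^2 \<in> \<int>" by (simp add: r_def)
    then have "x \<noteq> 6*r^2" using that by (auto simp: S_def)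
    then show ?thesis
      using quartic_to_quadrics curve_to_quartic[OF Y[OF that]] by (simp add: \<Phi>_def r_def)
  qed
  then have "(\<lambda>x. scalar_rel `` {\<Phi> x}) ` S \<subseteq> solutions h // scalar_rel"
    by (auto intro: quotientI)
  moreover have "inj_on (\<lambda>x. scalar_rel `` {\<Phi> x}) S"
  proof (rule inj_onI)
    fix x x' assume "scalar_rel `` {\<Phi> x} = scalar_rel `` {\<Phi> x'}"
    then have "(\<Phi> x, \<Phi> x') \<in> scalar_rel"
      by (rule eq_equiv_class[OF _ equiv_scalar_rel]) simp
    then show "x = x'" unfolding \<Phi>_def by (rule abscissa_determined_by_class)
  qed
  ultimately show ?thesis
    using \<open>infinite S\<close> by (meson finite_imageD finite_subset)
qed

theorem mainTheorem6:
  fixes n :: nat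
  assumes "n > 0"
  shows "infinite {h :: int. at_least_n_solutions n h}"
proof -
  have "at_least_n_solutions n h" if "h > 0" for h
    using infinite_arbitrarily_large[OF infinite_solution_classes[OF that]]
    unfolding at_least_n_solutions_def by blast
  then have "{0<..} \<subseteq> {h :: int. at_least_n_solutions n h}" by auto
  then show ?thesis by (rule infinite_super) (rule infinite_Ioi)
qed

end
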